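(* Let $0<\mu\le L$ and let $f\in\mathcal{S}^1_{\mu,L}(\mathbb{R}^n)$ with minimizer $x^\star$. If the step size is set to $s=\mu/(16L^2)$, then the iterates $\{x_k\}_{k=0}^\infty$ generated by the heavy-ball method $$x_{k+1}=x_k+\frac{1-\sqrt{\mu s}}{1+\sqrt{\mu s}}\,(x_k-x_{k-1})-s\nabla f(x_k)\qquad(k\ge 1),$$ started from any $x_0\in\mathbb{R}^n$ and $x_1=x_0-\frac{2s\nabla f(x_0)}{1+\sqrt{\mu s}}$, satisfy $$f(x_k)-f(x^\star)\le \frac{5L\|x_0-x^\star\|^2}{\left(1+\frac{\mu}{16L}\right)^k}$$ for all $k\ge 0$.
   Context: $\|\cdot\|$ is the Euclidean norm. $\mathcal{S}^1_{\mu,L}(\mathbb{R}^n)$ is the class of differentiable convex functions $f:\mathbb{R}^n\to\mathbb{R}$ whose gradient is $L$-Lipschitz ($\|\nabla f(x)-\nabla f(y)\|\le L\|x-y\|$ for all $x,y$) and which are $\mu$-strongly convex: $f(y)\ge f(x)+\langle\nabla f(x),y-x\rangle+\frac{\mu}{2}\|y-x\|^2$ for all $x,y\in\mathbb{R}^n$. *)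

theory Defs
  imports "HOL-Analysis.Analysis"
begin

definition grad :: "('a::euclidean_space \<Rightarrow> real) \<Rightarrow> 'a \<Rightarrow> 'a" where
  "grad f x = (THE D. GDERIV f x :> D)"

lemma gderiv_unique:
  fixes f :: "'a::euclidean_space \<Rightarrow> real"
  assumes "GDERIV f x :> D" "GDERIV f x :> E"
  shows "D = E"
proof -
  have "(\<lambda>h. inner h D) = (\<lambda>h. inner h E)"
    using assms unfolding gderiv_def by (rule has_derivative_unique)
  then have "inner h D = inner h E" for h
    by metis
  then show ?thesis
    by (meson vector_eq_ldot)
qed

lemma grad_eqI:
  fixes f :: "'a::euclidean_space \<Rightarrow> real"
  assumes "GDERIV f x :> D"
  shows "grad f x = D"
  unfolding grad_def using assms gderiv_unique by blast

lemma gderiv_grad: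
  fixes f :: "'a::euclidean_space \<Rightarrow> real"
  assumes "f differentiable (at x)"
  shows "GDERIV f x :> grad f x"
proof -
  from assms obtain f' where f': "(f has_derivative f') (at x)"
    by (auto simp: differentiable_def)
  then have "linear f'"
    by (rule has_derivative_linear)
  then have "f' = (\<lambda>h. inner h (adjoint f' 1))"
    by (simp add: adjoint_works)
  with f' have "GDERIV f x :> adjoint f' 1"
    unfolding gderiv_def by metis
  then show ?thesis
    using grad_eqI by metis
qed

definition smooth_strongly_convex :: "real \<Rightarrow> real \<Rightarrow> ('a::euclidean_space \<Rightarrow> real) set" where
  "smooth_strongly_convex \<mu> L = {f.
     (\<forall>x. f differentiable (at x)) \<and>
     convex_on UNIV f \<and>
     (\<forall>x y. norm (grad f x - grad f y) \<le> L * norm (x - y)) \<and>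
     (\<forall>x y. f y \<ge> f x + inner (grad f x) (y - x) + \<mu> / 2 * (norm (y - x))\<^sup>2)}"

end

theory Submission
  imports Defs
begin

text \<open>
  Write \<open>q = sqrt (\<mu> * s) = \<mu> / (4 * L)\<close>, so that \<open>s * L = q / 4\<close>, and \<open>d k = x (k + 1) - x k\<close>. The
  Lyapunov function
  \<open>4 (1 - q\<^sup>2) s (f (x k) - f x\<^sup>*) + (1 - q)\<^sup>2 \<parallel>d k\<parallel>\<^sup>2 + \<parallel>(1 + q) d k + 2 q (x k - x\<^sup>*)\<parallel>\<^sup>2\<close>
  decreases by the factor \<open>1 + q / 4\<close> in every step: the iteration in the form
  \<open>(1 - q) d k = (1 + q) (d (k + 1) + s \<nabla>f (x (k + 1)))\<close> makes all mixed terms in \<open>\<nabla>f\<close> and \<open>d\<close>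
  cancel, and strong convexity together with \<open>\<parallel>\<nabla>f\<parallel>\<^sup>2 \<le> 4 L (f - f x\<^sup>*)\<close> controls the rest. This
  last bound, with 4 in place of the optimal 2, follows from convexity and the Lipschitz property
  alone, without integrating the gradient.
\<close>

text \<open>Convexity at \<open>y\<close> bounds \<open>f y - f x\<close> by
  \<open>inner (g y) (y - x)\<close>; replacing \<open>g y\<close> by \<open>g x\<close> costs at
  most \<open>L * (norm (y - x))\<^sup>2\<close> by Cauchy-Schwarz.\<close>

lemma convex_lipschitz_upper_bound:
  fixes f :: "'a::real_inner \<Rightarrow> real" and g :: "'a \<Rightarrow> 'a"
  assumes lip: "\<And>x y. norm (g x - g y) \<le> L * norm (x - y)"
    and sub: "\<And>x y. f y \<ge> f x + inner (g x) (y - x)"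
  shows "f y \<le> f x + inner (g x) (y - x) + L * (norm (y - x))\<^sup>2"
proof -
  have "inner (g y - g x) (y - x) \<le> norm (g y - g x) * norm (y - x)"
    by (rule norm_cauchy_schwarz)
  also have "\<dots> \<le> L * norm (y - x) * norm (y - x)"
    by (intro mult_right_mono lip) simp
  finally have "inner (g y - g x) (y - x) \<le> L * (norm (y - x))\<^sup>2"
    by (simp add: power2_eq_square mult.assoc)
  moreover have "f x \<ge> f y - inner (g y) (y - x)"
    using sub[of y x] by (simp add: inner_diff_right)
  ultimately show ?thesis
    by (simp add: inner_diff_left)
qed

lemma norm_gradient_le_suboptimality:
  fixes f :: "'a::real_inner \<Rightarrow> real" and g :: "'a \<Rightarrow> 'a"
  assumes lip: "\<And>x y. norm (g x - g y) \<le> L * norm (x - y)"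
    and sub: "\<And>x y. f y \<ge> f x + inner (g x) (y - x)"
    and "0 < L" and min: "\<And>y. f z \<le> f y"
  shows "(norm (g x))\<^sup>2 \<le> 4 * L * (f x - f z)"
proof -
  \<comment> \<open>This point minimises the bound of \<open>convex_lipschitz_upper_bound\<close>,
    whose value there is \<open>f x - (norm (g x))\<^sup>2 / (4 * L)\<close>.\<close>
  define y where "y = x - (1 / (2 * L)) *\<^sub>R g x"
  have "f z \<le> f y" by (rule min)
  also have "\<dots> \<le> f x + inner (g x) (y - x) + L * (norm (y - x))\<^sup>2"
    by (rule convex_lipschitz_upper_bound[OF lip sub])
  also have "inner (g x) (y - x) = - (norm (g x))\<^sup>2 / (2 * L)"
    by (simp add: y_def power2_norm_eq_inner)
  also have "(norm (y - x))\<^sup>2 = (norm (g x))\<^sup>2 / (2 * L)\<^sup>2"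
    by (simp add: y_def power_mult_distrib power_divide)
  finally show ?thesis
    using \<open>0 < L\<close> by (simp add: field_simps power2_eq_square)
qed

definition heavy_ball_lyapunov :: "real \<Rightarrow> real \<Rightarrow> real \<Rightarrow> 'a::real_inner \<Rightarrow> 'a \<Rightarrow> real" where
  "heavy_ball_lyapunov q s F X d =
     4 * (1 - q\<^sup>2) * s * F + (1 - q)\<^sup>2 * (norm d)\<^sup>2 + (norm ((1 + q) *\<^sub>R d + (2 * q) *\<^sub>R X))\<^sup>2"

text \<open>
  Here \<open>F\<close>, \<open>X\<close>, \<open>d\<close> are suboptimality, displacement from the minimizer and increment at the old
  iterate, and \<open>F'\<close>, \<open>X + d\<close>, \<open>d'\<close> at the new one, whose gradient is \<open>g\<close>.
\<close>

lemma heavy_ball_lyapunov_decrease: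
  fixes X d d' g :: "'a::real_inner"
  assumes q: "0 < q" "q \<le> 1 / 4" and s: "0 < s" "s * L = q / 4" "s * \<mu> = q\<^sup>2"
    and rec: "(1 - q) *\<^sub>R d = (1 + q) *\<^sub>R (d' + s *\<^sub>R g)"
    and conv: "F \<ge> F' - inner g d"
    and strong: "inner g (X + d) \<ge> F' + \<mu> / 2 * (norm (X + d))\<^sup>2"
    and grad: "(norm g)\<^sup>2 \<le> 4 * L * F'"
    and "0 \<le> F'"
  shows "(1 + q / 4) * heavy_ball_lyapunov q s F' (X + d) d' \<le> heavy_ball_lyapunov q s F X d"
proof -
  define Y where "Y = X + d"
  \<comment> \<open>\<open>rec\<close> eliminates \<open>d\<close>, and \<open>Y\<close> replaces
    \<open>X\<close>, so that the claim becomes linear in \<open>F\<close>, \<open>F'\<close> and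
    these six products.\<close>
  define D G P R Q N where defs: "D = inner d' d'" "G = inner g g" "P = inner g d'"
    "R = inner d' Y" "Q = inner g Y" "N = inner Y Y"
  have new: "heavy_ball_lyapunov q s F' (X + d) d' =
      4 * (1 - q\<^sup>2) * s * F' + (1 - q)\<^sup>2 * D + ((1 + q)\<^sup>2 * D + 4 * q * (1 + q) * R + 4 * q\<^sup>2 * N)"
    unfolding heavy_ball_lyapunov_def Y_def[symmetric] defs power2_norm_eq_inner
    by (simp add: inner_add_left inner_add_right inner_commute[of Y d'] algebra_simps power2_eq_square)
  have "(1 - q)\<^sup>2 * (norm d)\<^sup>2 = (norm ((1 + q) *\<^sub>R (d' + s *\<^sub>R g)))\<^sup>2"
    unfolding rec[symmetric] by (simp add: power_mult_distrib)
  also have "\<dots> = (1 + q)\<^sup>2 * (D + 2 * s * P + s\<^sup>2 * G)"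
    unfolding defs power2_norm_eq_inner
    by (simp add: inner_add_left inner_add_right inner_commute[of d' g] algebra_simps power2_eq_square)
  finally have old1: "(1 - q)\<^sup>2 * (norm d)\<^sup>2 = (1 + q)\<^sup>2 * (D + 2 * s * P + s\<^sup>2 * G)" .
  \<comment> \<open>Substituting \<open>X = Y - d\<close> turns the coefficient \<open>1 + q\<close>
    into \<open>1 - q\<close>, which makes \<open>rec\<close> applicable.\<close>
  have "(1 + q) *\<^sub>R d + (2 * q) *\<^sub>R X = (1 - q) *\<^sub>R d + (2 * q) *\<^sub>R Y"
    by (simp add: Y_def algebra_simps scaleR_2 flip: scaleR_scaleR)
  then have "(norm ((1 + q) *\<^sub>R d + (2 * q) *\<^sub>R X))\<^sup>2
      = (norm ((1 + q) *\<^sub>R (d' + s *\<^sub>R g) + (2 * q) *\<^sub>R Y))\<^sup>2"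
    by (simp only: rec)
  also have "\<dots> = (1 + q)\<^sup>2 * (D + 2 * s * P + s\<^sup>2 * G) + 4 * q * (1 + q) * (R + s * Q) + 4 * q\<^sup>2 * N"
    unfolding defs power2_norm_eq_inner
    by (simp add: inner_add_left inner_add_right inner_commute[of d' g] inner_commute[of Y d']
        inner_commute[of Y g] algebra_simps power2_eq_square)
  finally have old: "heavy_ball_lyapunov q s F X d = 4 * (1 - q\<^sup>2) * s * F
      + 2 * ((1 + q)\<^sup>2 * (D + 2 * s * P + s\<^sup>2 * G)) + 4 * q * (1 + q) * (R + s * Q) + 4 * q\<^sup>2 * N"
    unfolding heavy_ball_lyapunov_def old1 by simp
  have "(1 - q) * inner g d = inner g ((1 - q) *\<^sub>R d)" by simp
  also have "\<dots> = (1 + q) * (P + s * G)"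
    unfolding rec by (simp add: defs inner_add_right)
  finally have gd: "(1 - q) * inner g d = (1 + q) * (P + s * G)" .
  \<comment> \<open>The weight of \<open>F\<close> in the Lyapunov function is chosen so that the
    \<open>P\<close> term arising here cancels the one in \<open>old\<close>.\<close>
  have "4 * (1 + q) * s * ((1 - q) * (F' - inner g d)) \<le> 4 * (1 + q) * s * ((1 - q) * F)"
    using conv q s by (intro mult_left_mono) auto
  then have F: "4 * (1 - q\<^sup>2) * s * F \<ge> 4 * (1 - q\<^sup>2) * s * F' - 4 * (1 + q)\<^sup>2 * s * (P + s * G)"
    using arg_cong[OF gd, of "\<lambda>t. 4 * (1 + q) * s * t"] by (simp add: algebra_simps power2_eq_square)
  have "s * Q \<ge> s * (F' + \<mu> / 2 * N)"
    using strong s by (simp add: defs Y_def power2_norm_eq_inner)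
  then have "s * Q \<ge> s * F' + (s * \<mu>) / 2 * N" by (simp add: algebra_simps)
  then have Q: "4 * q * (1 + q) * (s * Q) \<ge> 4 * q * (1 + q) * (s * F' + q\<^sup>2 / 2 * N)"
    using q by (simp add: s)
  \<comment> \<open>After that cancellation \<open>G\<close> survives with exactly this coefficient
    and a negative sign.\<close>
  have "2 * (1 + q)\<^sup>2 * s\<^sup>2 * G \<le> 2 * (1 + q)\<^sup>2 * s\<^sup>2 * (4 * L * F')"
    using grad by (intro mult_left_mono) (simp_all add: defs power2_norm_eq_inner)
  also have "\<dots> = 2 * (1 + q)\<^sup>2 * s * (4 * (s * L)) * F'"
    by (simp add: power2_eq_square)
  also have "\<dots> = 2 * (1 + q)\<^sup>2 * q * (s * F')"
    unfolding s(2) by simp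
  finally have G: "2 * (1 + q)\<^sup>2 * s\<^sup>2 * G \<le> 2 * (1 + q)\<^sup>2 * q * (s * F')" .
  \<comment> \<open>The extra \<open>R\<close> term, produced by the factor \<open>1 + q / 4\<close>
    on the new value, is traded for \<open>D\<close> and \<open>N\<close>.\<close>
  have "0 \<le> inner ((1 + q) *\<^sub>R d' - (2 * q) *\<^sub>R Y) ((1 + q) *\<^sub>R d' - (2 * q) *\<^sub>R Y)" by simp
  also have "\<dots> = (1 + q)\<^sup>2 * D + 4 * q\<^sup>2 * N - 4 * q * (1 + q) * R"
    unfolding defs
    by (simp add: inner_diff_left inner_diff_right inner_commute[of Y d'] algebra_simps power2_eq_square)
  finally have R: "q / 4 * (4 * q * (1 + q) * R) \<le> q / 4 * ((1 + q)\<^sup>2 * D + 4 * q\<^sup>2 * N)"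
    using q by (intro mult_left_mono) auto
  \<comment> \<open>With \<open>F\<close>, \<open>Q\<close>, \<open>G\<close> and \<open>R\<close>
    added up, the remaining slack consists of this term in \<open>s * F'\<close>, the one in
    \<open>N\<close> and the one in \<open>D\<close> below.\<close>
  have u: "0 \<le> q * (1 + q) * (1 - q) * (s * F')"
    using q s \<open>0 \<le> F'\<close> by simp
  have N: "0 \<le> 2 * q ^ 4 * N" by (simp add: defs)
  have "(1 - q)\<^sup>2 \<le> 1" "(1 + q)\<^sup>2 \<le> 4"
    using q power_mono[of "1 - q" 1 2] power_mono[of "1 + q" 2 2] by auto
  then have "0 \<le> q / 4 * (16 - (1 - q)\<^sup>2 - 2 * (1 + q)\<^sup>2) * D"
    using q by (intro mult_nonneg_nonneg) (auto simp: defs)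
  with F Q G R u N show ?thesis
    unfolding new old by (simp add: algebra_simps power2_eq_square power4_eq_xxxx)
qed

text \<open>By \<open>start\<close>, \<open>d\<close> is a multiple of \<open>g\<close>, so
  everything reduces to \<open>(norm X)\<^sup>2\<close>. Of the factor 5, the term in
  \<open>F\<close> takes 1 and the two squares take 4, since \<open>4 * (s * L) = q\<close>.\<close>

lemma heavy_ball_lyapunov_initial:
  fixes X d g :: "'a::real_inner"
  assumes q: "0 < q" "q \<le> 1 / 4" and s: "0 < s" "s * L = q / 4"
    and start: "(1 + q) *\<^sub>R d = - (2 * s) *\<^sub>R g"
    and "F \<le> inner g X" and "0 \<le> inner g X" and "0 < L"
    and lip: "norm g \<le> L * norm X"
  shows "heavy_ball_lyapunov q s F X d \<le> 4 * (1 - q\<^sup>2) * s * (5 * L * (norm X)\<^sup>2)"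
proof -
  define N where "N = (norm X)\<^sup>2"
  have "inner g X \<le> norm g * norm X" by (rule norm_cauchy_schwarz)
  also have "\<dots> \<le> L * norm X * norm X" by (intro mult_right_mono lip) simp
  finally have "F \<le> L * N" using assms by (simp add: N_def power2_eq_square)
  then have F: "4 * (1 - q\<^sup>2) * s * F \<le> 4 * (1 - q\<^sup>2) * s * (L * N)"
    using q s by (intro mult_left_mono) (auto simp: power_le_one)
  have "s * norm g \<le> s * (L * norm X)"
    using lip s by (intro mult_left_mono) auto
  then have "(s * norm g)\<^sup>2 \<le> ((s * L) * norm X)\<^sup>2"
    using s by (intro power_mono) (auto simp: mult_ac)
  then have G: "s\<^sup>2 * (norm g)\<^sup>2 \<le> q\<^sup>2 / 16 * N"
    by (simp add: s N_def power_mult_distrib power_divide)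
  have "(1 - q)\<^sup>2 * (norm d)\<^sup>2 \<le> (1 + q)\<^sup>2 * (norm d)\<^sup>2"
    using q by (intro mult_right_mono power_mono) auto
  also have "\<dots> = (norm ((1 + q) *\<^sub>R d))\<^sup>2" by (simp add: power_mult_distrib)
  also have "\<dots> = 4 * (s\<^sup>2 * (norm g)\<^sup>2)" unfolding start by (simp add: power_mult_distrib)
  finally have D: "(1 - q)\<^sup>2 * (norm d)\<^sup>2 \<le> 4 * (s\<^sup>2 * (norm g)\<^sup>2)" .
  have "(norm ((1 + q) *\<^sub>R d + (2 * q) *\<^sub>R X))\<^sup>2
      = 4 * (s\<^sup>2 * (norm g)\<^sup>2) + 4 * q\<^sup>2 * N - 8 * s * q * inner g X"
    unfolding start N_def power2_norm_eq_inner
    by (simp add: inner_diff_left inner_diff_right inner_commute[of X g] algebra_simps power2_eq_square)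
  moreover have "0 \<le> 8 * s * q * inner g X" using assms by simp
  \<comment> \<open>The constant is \<open>9 / 2 = 4 + 1 / 4 + 1 / 4\<close>: the part from
    \<open>(2 * q) *\<^sub>R X\<close> and two copies of the bound \<open>G\<close> times 4.\<close>
  moreover have "q * (9 / 2 * q) * N \<le> q * (4 * (1 - q\<^sup>2)) * N"
    using q power_mono[of q "1/4" 2]
    by (intro mult_right_mono mult_left_mono) (auto simp: N_def power2_eq_square)
  ultimately have "heavy_ball_lyapunov q s F X d \<le> 4 * (1 - q\<^sup>2) * s * (L * N) + 4 * q * (1 - q\<^sup>2) * N"
    using F D G unfolding heavy_ball_lyapunov_def by (simp add: algebra_simps power2_eq_square)
  also have "\<dots> = 4 * (1 - q\<^sup>2) * (s * L) * N + 4 * q * (1 - q\<^sup>2) * N" by simp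
  also have "\<dots> = 4 * (1 - q\<^sup>2) * (5 * (s * L)) * N" by (simp add: s)
  finally show ?thesis by (simp add: N_def algebra_simps)
qed

theorem theorem4:
  fixes f :: "real ^ 'n \<Rightarrow> real"
    and x :: "nat \<Rightarrow> real ^ 'n"
    and xstar :: "real ^ 'n"
    and \<mu> L s :: real
  assumes "0 < \<mu>" and "\<mu> \<le> L"
    and "f \<in> smooth_strongly_convex \<mu> L"
    and "\<forall>y. f xstar \<le> f y"
    and "s = \<mu> / (16 * L\<^sup>2)"
    and "x 1 = x 0 - (2 * s / (1 + sqrt (\<mu> * s))) *\<^sub>R grad f (x 0)"
    and "\<forall>k\<ge>1. x (k + 1) = x k
           + ((1 - sqrt (\<mu> * s)) / (1 + sqrt (\<mu> * s))) *\<^sub>R (x k - x (k - 1))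
           - s *\<^sub>R grad f (x k)"
  shows "\<forall>k. f (x k) - f xstar
           \<le> 5 * L * (norm (x 0 - xstar))\<^sup>2 / (1 + \<mu> / (16 * L)) ^ k"
proof -
  define q where "q = \<mu> / (4 * L)"
  define g where "g = grad f"
  define d where "d k = x (k + 1) - x k" for k
  define E where "E k = heavy_ball_lyapunov q s (f (x k) - f xstar) (x k - xstar) (d k)" for k
  have L: "0 < L" using assms by simp
  have q: "0 < q" "q \<le> 1 / 4" using assms L by (auto simp: q_def field_simps)
  have s: "0 < s" "s * L = q / 4" "s * \<mu> = q\<^sup>2"
    unfolding assms(5) using assms(1) L by (auto simp: q_def field_simps power2_eq_square)
  have sqrt: "sqrt (\<mu> * s) = q"
    using s(3) q(1) by (simp add: mult.commute)
  have lip: "norm (g y - g z) \<le> L * norm (y - z)" for y z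
    using assms(3) by (simp add: smooth_strongly_convex_def g_def)
  have strong: "f z \<ge> f y + inner (g y) (z - y) + \<mu> / 2 * (norm (z - y))\<^sup>2" for y z
    using assms(3) by (simp add: smooth_strongly_convex_def g_def)
  have sub: "f z \<ge> f y + inner (g y) (z - y)" for y z
    by (rule order_trans[OF _ strong[of y z]]) (use \<open>0 < \<mu>\<close> in simp)
  have min: "f xstar \<le> f y" for y using assms(4) by simp
  have grad: "(norm (g y))\<^sup>2 \<le> 4 * L * (f y - f xstar)" for y
    by (rule norm_gradient_le_suboptimality[OF lip sub L min])
  \<comment> \<open>At the minimizer the right-hand side of \<open>grad\<close> vanishes.\<close>
  have "g xstar = 0" using grad[of xstar] by simp
  have at_min: "inner (g y) (y - xstar) \<ge> f y - f xstar + \<mu> / 2 * (norm (y - xstar))\<^sup>2" for y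
    using strong[of y xstar] by (simp add: inner_diff_right norm_minus_commute)
  \<comment> \<open>The recursion starts at index 1, so its instance at \<open>Suc k\<close> covers
    every \<open>k\<close>, including 0.\<close>
  have rec: "(1 - q) *\<^sub>R d k = (1 + q) *\<^sub>R (d (Suc k) + s *\<^sub>R g (x (Suc k)))" for k
  proof -
    have "d (Suc k) + s *\<^sub>R g (x (Suc k)) = ((1 - q) / (1 + q)) *\<^sub>R d k"
      using assms(7)[rule_format, of "Suc k"] unfolding sqrt by (simp add: d_def g_def)
    then show ?thesis using q by simp
  qed
  have step: "(1 + q / 4) * E (Suc k) \<le> E k" for k
  proof -
    have X: "x k - xstar + d k = x (Suc k) - xstar" by (simp add: d_def)
    have "f (x k) - f xstar \<ge> f (x (Suc k)) - f xstar - inner (g (x (Suc k))) (d k)"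
      using sub[of "x (Suc k)" "x k"] by (simp add: d_def inner_diff_right)
    with heavy_ball_lyapunov_decrease[OF q s rec[of k], where X = "x k - xstar"
        and F = "f (x k) - f xstar" and F' = "f (x (Suc k)) - f xstar"]
    show ?thesis unfolding E_def X using at_min grad min by simp
  qed
  have E_le: "E k * (1 + q / 4) ^ k \<le> E 0" for k
  proof (induction k)
    case (Suc k)
    have "E (Suc k) * (1 + q / 4) ^ Suc k = (1 + q / 4) * E (Suc k) * (1 + q / 4) ^ k" by simp
    also have "\<dots> \<le> E k * (1 + q / 4) ^ k" using q by (intro mult_right_mono step) auto
    finally show ?case using Suc by linarith
  qed simp
  have start: "(1 + q) *\<^sub>R d 0 = - (2 * s) *\<^sub>R g (x 0)"
    using assms(6) q unfolding sqrt by (simp add: d_def g_def)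
  have E0: "E 0 \<le> 4 * (1 - q\<^sup>2) * s * (5 * L * (norm (x 0 - xstar))\<^sup>2)"
    unfolding E_def
  proof (rule heavy_ball_lyapunov_initial[OF q s(1,2) start _ _ L])
    show "f (x 0) - f xstar \<le> inner (g (x 0)) (x 0 - xstar)"
      using sub[of "x 0" xstar] by (simp add: inner_diff_right)
    then show "0 \<le> inner (g (x 0)) (x 0 - xstar)" using min[of "x 0"] by linarith
    show "norm (g (x 0)) \<le> L * norm (x 0 - xstar)"
      using lip[of "x 0" xstar] \<open>g xstar = 0\<close> by simp
  qed
  have c: "0 < 4 * (1 - q\<^sup>2) * s"
    using q s power_mono[of q "1/4" 2] by (simp add: power2_eq_square)
  have "f (x k) - f xstar \<le> 5 * L * (norm (x 0 - xstar))\<^sup>2 / (1 + q / 4) ^ k" for k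
  proof -
    \<comment> \<open>Both squares in the Lyapunov function are dropped; the weight of the gap then
      cancels against the same weight in \<open>E0\<close>.\<close>
    have "4 * (1 - q\<^sup>2) * s * (f (x k) - f xstar) \<le> E k"
      unfolding E_def heavy_ball_lyapunov_def by simp
    then have "4 * (1 - q\<^sup>2) * s * (f (x k) - f xstar) * (1 + q / 4) ^ k \<le> E k * (1 + q / 4) ^ k"
      using q by (intro mult_right_mono) auto
    then have "4 * (1 - q\<^sup>2) * s * ((f (x k) - f xstar) * (1 + q / 4) ^ k)
        \<le> 4 * (1 - q\<^sup>2) * s * (5 * L * (norm (x 0 - xstar))\<^sup>2)"
      using E_le[of k] E0 by (simp add: mult.assoc)
    then have "(f (x k) - f xstar) * (1 + q / 4) ^ k \<le> 5 * L * (norm (x 0 - xstar))\<^sup>2"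
      using c by (rule mult_left_le_imp_le)
    then show ?thesis using q by (simp add: pos_le_divide_eq)
  qed
  then show ?thesis by (simp add: q_def mult.commute)
qed

end
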